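(* Let $p$ be a prime number and let $t\in \mathbb{Z}_p^*$ with $t\neq 1$. Let $Q=\mathbb{Z}_p$ be the Alexander quandle with operation $a^b = ta+(1-t)b$. Then any two elements $a,b\in Q$ with $a\neq b$ generate $Q$.
   Context: $\mathbb{Z}_p$ denotes $\mathbb{Z}/p\mathbb{Z}$ and $\mathbb{Z}_p^*$ its group of invertible elements. A quandle is a set $X$ with a binary operation $(a,b)\mapsto a^b$ such that: (1) for all $a,b\in X$ there is a unique $c\in X$ with $a=c^b$; (2) $(a^b)^c=(a^c)^{b^c}$ for all $a,b,c\in X$; (3) $a^a=a$ for all $a\in X$. The Alexander quandle on $\mathbb{Z}_p$ associated with $t\in\mathbb{Z}_p^*$ is the set $\mathbb{Z}_p$ with the operation $a^b=ta+(1-t)b$. A subquandle of a quandle $X$ is a subset of $X$ closed under the quandle operation. A subset $A\subseteq X$ generates the subquandle $X'$ if $X'$ is the smallest (with respect to inclusion) subquandle of $X$ containing $A$; thus $a,b$ generate $Q$ if the smallest subquandle of $Q$ containing $\{a,b\}$ is $Q$ itself. *)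

theory Defs
  imports "HOL-Number_Theory.Residues"
begin

text \<open>We write \<open>q a b\<close> for $a^b$. The operation is only constrained on the carrier.\<close>

locale quandle =
  fixes X :: "'a set" and q :: "'a \<Rightarrow> 'a \<Rightarrow> 'a"
  assumes closed: "\<And>a b. \<lbrakk>a \<in> X; b \<in> X\<rbrakk> \<Longrightarrow> q a b \<in> X"
    and right_division: "\<And>a b. \<lbrakk>a \<in> X; b \<in> X\<rbrakk> \<Longrightarrow> \<exists>!c. c \<in> X \<and> a = q c b"
    and self_distrib: "\<And>a b c. \<lbrakk>a \<in> X; b \<in> X; c \<in> X\<rbrakk> \<Longrightarrow> q (q a b) c = q (q a c) (q b c)"
    and idem: "\<And>a. a \<in> X \<Longrightarrow> q a a = a"
begin

definition subquandle :: "'a set \<Rightarrow> bool" where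
  "subquandle Y \<longleftrightarrow> Y \<subseteq> X \<and> (\<forall>a\<in>Y. \<forall>b\<in>Y. q a b \<in> Y)"

definition generates :: "'a set \<Rightarrow> 'a set \<Rightarrow> bool" where
  "generates A X' \<longleftrightarrow>
     subquandle X' \<and> A \<subseteq> X' \<and> (\<forall>Y. subquandle Y \<and> A \<subseteq> Y \<longrightarrow> X' \<subseteq> Y)"

end

definition alexander_op :: "('a, 'b) ring_scheme \<Rightarrow> 'a \<Rightarrow> 'a \<Rightarrow> 'a \<Rightarrow> 'a" where
  "alexander_op R t a b =
     t \<otimes>\<^bsub>R\<^esub> a \<oplus>\<^bsub>R\<^esub> (\<one>\<^bsub>R\<^esub> \<ominus>\<^bsub>R\<^esub> t) \<otimes>\<^bsub>R\<^esub> b"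

lemma (in cring) quandle_alexander:
  assumes t: "t \<in> Units R"
  shows "quandle (carrier R) (alexander_op R t)"
proof
  have tR [simp]: "t \<in> carrier R" using t by auto
  show "alexander_op R t a b \<in> carrier R" if "a \<in> carrier R" "b \<in> carrier R" for a b
    using that by (simp add: alexander_op_def)
  show "\<exists>!c. c \<in> carrier R \<and> a = alexander_op R t c b"
    if a: "a \<in> carrier R" and b: "b \<in> carrier R" for a b
  proof -
    have iR [simp]: "inv t \<in> carrier R" using t by simp
    define d where "d = (\<one> \<ominus> t) \<otimes> b"
    have d [simp]: "d \<in> carrier R" using b by (simp add: d_def)
    show ?thesis
    proof (rule ex1I [of _ "inv t \<otimes> (a \<ominus> d)"])
      have "t \<otimes> (inv t \<otimes> (a \<ominus> d)) = a \<ominus> d"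
        using a t by (simp add: m_assoc [symmetric])
      then show "inv t \<otimes> (a \<ominus> d) \<in> carrier R \<and> a = alexander_op R t (inv t \<otimes> (a \<ominus> d)) b"
        using a by (simp add: alexander_op_def d_def [symmetric]) (simp add: a_minus_def a_assoc l_neg)
    next
      fix c assume c: "c \<in> carrier R \<and> a = alexander_op R t c b"
      then have "a \<ominus> d = t \<otimes> c"
        by (simp add: alexander_op_def d_def [symmetric]) (simp add: a_minus_def a_assoc r_neg)
      then show "c = inv t \<otimes> (a \<ominus> d)"
        using c t by (simp add: m_assoc [symmetric])
    qed
  qed
  show "alexander_op R t (alexander_op R t a b) c
      = alexander_op R t (alexander_op R t a c) (alexander_op R t b c)"
    if "a \<in> carrier R" "b \<in> carrier R" "c \<in> carrier R" for a b c
    using that tR unfolding alexander_op_def by algebra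
  show "alexander_op R t a a = a" if "a \<in> carrier R" for a
    using that tR unfolding alexander_op_def by algebra
qed

end

theory Submission
  imports Defs
begin

text \<open>
  Given a subset \<open>Y\<close> closed under the operation with parameter \<open>t\<close>, consider all scalars
  \<open>s\<close> for which \<open>Y\<close> is closed under \<open>(x, y) \<mapsto> s x + (1 - s) y\<close>.
  Nesting such affine combinations shows that these scalars are closed under
  \<open>(r, s, w) \<mapsto> r s + (1 - r) w\<close> (\<open>closing_scalars_combine\<close>). As they contain \<open>0\<close>,
  \<open>1\<close> and \<open>t\<close>, they are closed under products and contain \<open>1 - t\<close>. In a finite domain,
  multiplication by \<open>t\<close> and by \<open>1 - t\<close>, both nonzero, permutes this finite set of scalars.
  So two of its members can be written as \<open>t s\<close> and \<open>(1 - t) w\<close> with \<open>s\<close> and \<open>w\<close> in the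
  set, and their sum \<open>t s + (1 - t) w\<close> is again in the set (\<open>closing_scalars_add\<close>).
  An additively closed set that contains \<open>0\<close> and \<open>1\<close> is all of the residue ring. Hence \<open>Y\<close>
  contains the whole affine line through any two of its points, and in a field of residues
  the line through two distinct points is everything (\<open>field_affine_line\<close>).
\<close>

definition closing_scalars :: "('a, 'b) ring_scheme \<Rightarrow> 'a set \<Rightarrow> 'a set" where
  "closing_scalars R Y = {s \<in> carrier R. \<forall>x\<in>Y. \<forall>y\<in>Y. alexander_op R s x y \<in> Y}"

lemma (in cring) closing_scalars_zero:
  assumes "Y \<subseteq> carrier R"
  shows "\<zero> \<in> closing_scalars R Y"
proof -
  have "alexander_op R \<zero> x y = y" if "x \<in> carrier R" "y \<in> carrier R" for x y
    using that unfolding alexander_op_def by algebra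
  then show ?thesis
    using assms by (auto simp: closing_scalars_def subset_iff)
qed

lemma (in cring) closing_scalars_one:
  assumes "Y \<subseteq> carrier R"
  shows "\<one> \<in> closing_scalars R Y"
proof -
  have "alexander_op R \<one> x y = x" if "x \<in> carrier R" "y \<in> carrier R" for x y
    using that unfolding alexander_op_def by algebra
  then show ?thesis
    using assms by (auto simp: closing_scalars_def subset_iff)
qed

text \<open>An affine combination of two affine combinations of \<open>x\<close> and \<open>y\<close> is an affine
  combination of \<open>x\<close> and \<open>y\<close>, whose scalar is the same combination of the two scalars.\<close>

lemma (in cring) closing_scalars_combine:
  assumes Y: "Y \<subseteq> carrier R"
    and r: "r \<in> closing_scalars R Y" and s: "s \<in> closing_scalars R Y"
    and w: "w \<in> closing_scalars R Y"
  shows "alexander_op R r s w \<in> closing_scalars R Y"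
proof -
  have R: "r \<in> carrier R" "s \<in> carrier R" "w \<in> carrier R"
    using r s w by (auto simp: closing_scalars_def)
  have nest: "alexander_op R (alexander_op R r s w) x y
      = alexander_op R r (alexander_op R s x y) (alexander_op R w x y)"
    if "x \<in> carrier R" "y \<in> carrier R" for x y
    using that R unfolding alexander_op_def by algebra
  have "alexander_op R (alexander_op R r s w) x y \<in> Y" if "x \<in> Y" "y \<in> Y" for x y
    using that Y r s w by (subst nest) (auto simp: closing_scalars_def)
  moreover have "alexander_op R r s w \<in> carrier R"
    using R by (simp add: alexander_op_def)
  ultimately show ?thesis
    by (simp add: closing_scalars_def)
qed

lemma (in cring) closing_scalars_mult:
  assumes Y: "Y \<subseteq> carrier R"
    and r: "r \<in> closing_scalars R Y" and s: "s \<in> closing_scalars R Y"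
  shows "r \<otimes> s \<in> closing_scalars R Y"
proof -
  have "r \<in> carrier R" "s \<in> carrier R"
    using r s by (auto simp: closing_scalars_def)
  then have "alexander_op R r s \<zero> = r \<otimes> s"
    unfolding alexander_op_def by algebra
  then show ?thesis
    using closing_scalars_combine [OF Y r s closing_scalars_zero [OF Y]] by simp
qed

lemma (in cring) closing_scalars_complement:
  assumes Y: "Y \<subseteq> carrier R" and r: "r \<in> closing_scalars R Y"
  shows "\<one> \<ominus> r \<in> closing_scalars R Y"
proof -
  have "r \<in> carrier R"
    using r by (auto simp: closing_scalars_def)
  then have "alexander_op R r \<zero> \<one> = \<one> \<ominus> r"
    unfolding alexander_op_def by algebra
  then show ?thesis
    using closing_scalars_combine
      [OF Y r closing_scalars_zero [OF Y] closing_scalars_one [OF Y]] by simp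
qed

text \<open>Finiteness replaces inverses: multiplication by a nonzero closing scalar maps the set of
  closing scalars injectively into itself, hence onto itself.\<close>

lemma (in domain) closing_scalars_divide:
  assumes fin: "finite (carrier R)" and Y: "Y \<subseteq> carrier R"
    and r: "r \<in> closing_scalars R Y" and "r \<noteq> \<zero>" and u: "u \<in> closing_scalars R Y"
  obtains s where "s \<in> closing_scalars R Y" "u = r \<otimes> s"
proof -
  let ?S = "closing_scalars R Y"
  have S: "?S \<subseteq> carrier R"
    by (auto simp: closing_scalars_def)
  have "inj_on ((\<otimes>) r) ?S"
    using S r \<open>r \<noteq> \<zero>\<close> by (auto simp: inj_on_def m_lcancel subset_iff)
  moreover have "(\<otimes>) r ` ?S \<subseteq> ?S"
    using closing_scalars_mult [OF Y r] by auto
  ultimately have "(\<otimes>) r ` ?S = ?S"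
    using endo_inj_surj finite_subset [OF S fin] by blast
  then show ?thesis
    using u that by blast
qed

lemma (in domain) closing_scalars_add:
  assumes fin: "finite (carrier R)" and Y: "Y \<subseteq> carrier R"
    and t: "t \<in> closing_scalars R Y" and t0: "t \<noteq> \<zero>" and t1: "t \<noteq> \<one>"
    and u: "u \<in> closing_scalars R Y" and v: "v \<in> closing_scalars R Y"
  shows "u \<oplus> v \<in> closing_scalars R Y"
proof -
  have tR: "t \<in> carrier R"
    using t by (simp add: closing_scalars_def)
  obtain s where s: "s \<in> closing_scalars R Y" "u = t \<otimes> s"
    using closing_scalars_divide [OF fin Y t t0 u] .
  have "\<one> \<ominus> t \<noteq> \<zero>"
    using t1 tR by (metis one_closed r_right_minus_eq)
  then obtain w where w: "w \<in> closing_scalars R Y" "v = (\<one> \<ominus> t) \<otimes> w"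
    using closing_scalars_divide [OF fin Y closing_scalars_complement [OF Y t] _ v] by blast
  show ?thesis
    using closing_scalars_combine [OF Y t s(1) w(1)] s(2) w(2) by (simp add: alexander_op_def)
qed

lemma (in field) field_affine_line:
  assumes a: "a \<in> carrier R" and b: "b \<in> carrier R" and "a \<noteq> b" and c: "c \<in> carrier R"
  obtains s where "s \<in> carrier R" "c = alexander_op R s a b"
proof -
  have "a \<ominus> b \<noteq> \<zero>"
    using a b \<open>a \<noteq> b\<close> by simp
  then have U: "a \<ominus> b \<in> Units R"
    using a b field_Units by auto
  let ?i = "inv (a \<ominus> b)" and ?s = "(c \<ominus> b) \<otimes> inv (a \<ominus> b)"
  have i: "?i \<in> carrier R" "?i \<otimes> (a \<ominus> b) = \<one>"
    using U by auto
  have "alexander_op R ?s a b = (c \<ominus> b) \<otimes> (?i \<otimes> (a \<ominus> b)) \<oplus> b"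
    using a b c i(1) unfolding alexander_op_def by algebra
  also have "\<dots> = c"
    unfolding i(2) using b c by algebra
  finally show ?thesis
    using that [of ?s] b c i(1) by simp
qed

lemma (in residues) residues_additively_generated_by_one:
  assumes zero: "\<zero> \<in> S" and one: "\<one> \<in> S" and add: "\<And>u v. \<lbrakk>u \<in> S; v \<in> S\<rbrakk> \<Longrightarrow> u \<oplus> v \<in> S"
  shows "carrier R \<subseteq> S"
proof
  have nat: "int n mod m \<in> S" for n
  proof (induction n)
    case 0
    then show ?case using zero by (simp add: zero_cong)
  next
    case (Suc n)
    have "int (Suc n) mod m = (int n mod m) \<oplus> \<one>"
      by (simp add: res_add_eq one_cong mod_add_eq add.commute)
    then show ?case
      using add [OF Suc one] by simp
  qed
  fix x assume "x \<in> carrier R"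
  then have "x = int (nat x) mod m"
    by (simp add: res_carrier_eq)
  then show "x \<in> S"
    using nat [of "nat x"] by simp
qed

theorem theorem3p7:
  fixes p :: nat and t a b :: int
  defines "R \<equiv> residue_ring (int p)"
  assumes "prime p"
    and "t \<in> Units R" and "t \<noteq> \<one>\<^bsub>R\<^esub>"
    and "a \<in> carrier R" and "b \<in> carrier R" and "a \<noteq> b"
  shows "quandle.generates (carrier R) (alexander_op R t) {a, b} (carrier R)"
proof -
  interpret residues_prime p R
    using \<open>prime p\<close> by unfold_locales (simp_all add: R_def)
  interpret field R
    by (rule is_field)
  interpret Q: quandle "carrier R" "alexander_op R t"
    using quandle_alexander [OF \<open>t \<in> Units R\<close>] .
  have tR: "t \<in> carrier R" and t0: "t \<noteq> \<zero>\<^bsub>R\<^esub>"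
    using \<open>t \<in> Units R\<close> field_Units by auto
  have "carrier R \<subseteq> Y" if sub: "Q.subquandle Y" and ab: "a \<in> Y" "b \<in> Y" for Y
  proof
    have Y: "Y \<subseteq> carrier R" and t: "t \<in> closing_scalars R Y"
      using sub tR by (auto simp: Q.subquandle_def closing_scalars_def)
    have all: "carrier R \<subseteq> closing_scalars R Y"
      using residues_additively_generated_by_one closing_scalars_zero [OF Y]
        closing_scalars_one [OF Y] closing_scalars_add [OF finite Y t t0 \<open>t \<noteq> \<one>\<^bsub>R\<^esub>\<close>]
      by blast
    fix c assume "c \<in> carrier R"
    then obtain s where "s \<in> carrier R" "c = alexander_op R s a b"
      using field_affine_line \<open>a \<in> carrier R\<close> \<open>b \<in> carrier R\<close> \<open>a \<noteq> b\<close> by blast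
    then show "c \<in> Y"
      using all ab by (auto simp: closing_scalars_def)
  qed
  moreover have "Q.subquandle (carrier R)"
    by (simp add: Q.subquandle_def Q.closed)
  ultimately show ?thesis
    using \<open>a \<in> carrier R\<close> \<open>b \<in> carrier R\<close> by (auto simp: Q.generates_def)
qed

end
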